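(* Let $\lambda\le\kappa$ be regular infinite cardinals and let $\mathcal F=\{F_\xi(\alpha):\alpha\in C,\ \xi<\lambda\}$ be a $(\kappa,\lambda)$-matrix (indexed by a cofinal set $C\subseteq\kappa^+$). Then $\mathcal U(\mathcal F)$ is a neighborhood basis of the identity $\emptyset$ for a topology on $[\kappa^+]^{<\omega}$ which makes $([\kappa^+]^{<\omega},\triangle)$ a topological group.
   Context: Ordinals are identified with the set of smaller ordinals; $[X]^{<\omega}$ is the set of finite subsets of $X$; $\triangle$ is symmetric difference (so $([\kappa^+]^{<\omega},\triangle)$ is an abelian group with identity $\emptyset$). Let $\lambda\le\kappa$ be infinite regular cardinals and $C$ a cofinal subset of $\kappa^+$. A $(\kappa,\lambda)$-matrix indexed by $C$ is a family $\mathcal F=\{F_\xi(\alpha):\alpha\in C,\ \xi<\lambda\}$ of sets such that: (G1) $\bigcup_{\xi<\lambda}F_\xi(\alpha)=\alpha$ for every $\alpha\in C$; (G2) $F_\xi(\alpha)\subseteq F_\eta(\alpha)$ for each $\alpha\in C$ and all $\xi\le\eta<\lambda$; (G3) for all $\alpha\le\beta$ in $C$ and each $\xi<\lambda$ there is $\eta<\lambda$ with $F_\xi(\alpha)\subseteq F_\eta(\beta)$. For $\xi<\lambda$ and $\alpha\in C$ put $U_\xi(\alpha)=\{a\in[\kappa^+]^{<\omega}: a\cap F_\xi(\alpha)=\emptyset\}$, and $\mathcal U(\mathcal F)=\{U_\xi(\alpha):\xi<\lambda,\ \alpha\in C\}$. *)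

theory Defs
  imports "HOL-Analysis.Analysis" "HOL-Algebra.Group"
begin

unbundle cardinal_syntax

text \<open>
  Infinite cardinals \<open>\<kappa>\<close>, \<open>\<mu>\<close> are well-order relations satisfying \<open>Cinfinite\<close>, and \<open>\<kappa>\<^sup>+\<close> is
  \<open>cardSuc \<kappa>\<close>. The ordinals below a cardinal \<open>r\<close> are the elements of \<open>Field r\<close>, ordered by \<open>r\<close>;
  the ordinal \<open>\<alpha> \<in> Field r\<close>, seen as the set of smaller ordinals, is \<open>underS r \<alpha>\<close>. The cardinal
  usually called lambda is written \<open>\<mu>\<close>, since the former symbol is reserved.
\<close>

text \<open>
  The indices \<open>\<xi> < \<mu>\<close> are the elements of \<open>Field \<mu>\<close>; values \<open>F \<xi> \<alpha>\<close> outside \<open>Field \<mu> \<times> C\<close> are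
  irrelevant. \<open>cofinal C r\<close> asks for strictly larger elements of \<open>C\<close>, which for \<open>\<kappa>\<^sup>+\<close>, a limit
  ordinal, is the same as unboundedness.
\<close>

definition cardinal_matrix ::
  "'k rel \<Rightarrow> 'l rel \<Rightarrow> 'k set set \<Rightarrow> ('l \<Rightarrow> 'k set \<Rightarrow> 'k set set) \<Rightarrow> bool" where
  "cardinal_matrix \<kappa> \<mu> C F \<longleftrightarrow>
     C \<subseteq> Field (cardSuc \<kappa>) \<and> cofinal C (cardSuc \<kappa>) \<and>
     (\<forall>\<alpha>\<in>C. (\<Union>\<xi>\<in>Field \<mu>. F \<xi> \<alpha>) = underS (cardSuc \<kappa>) \<alpha>) \<and>
     (\<forall>\<alpha>\<in>C. \<forall>\<xi> \<eta>. (\<xi>, \<eta>) \<in> \<mu> \<longrightarrow> F \<xi> \<alpha> \<subseteq> F \<eta> \<alpha>) \<and>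
     (\<forall>\<alpha>\<in>C. \<forall>\<beta>\<in>C. (\<alpha>, \<beta>) \<in> cardSuc \<kappa> \<longrightarrow>
        (\<forall>\<xi>\<in>Field \<mu>. \<exists>\<eta>\<in>Field \<mu>. F \<xi> \<alpha> \<subseteq> F \<eta> \<beta>))"

definition matrix_nbhd ::
  "'k rel \<Rightarrow> ('l \<Rightarrow> 'k set \<Rightarrow> 'k set set) \<Rightarrow> 'l \<Rightarrow> 'k set \<Rightarrow> 'k set set set" where
  "matrix_nbhd \<kappa> F \<xi> \<alpha> = {a \<in> Fpow (Field (cardSuc \<kappa>)). a \<inter> F \<xi> \<alpha> = {}}"

definition matrix_nbhds ::
  "'k rel \<Rightarrow> 'l rel \<Rightarrow> 'k set set \<Rightarrow> ('l \<Rightarrow> 'k set \<Rightarrow> 'k set set) \<Rightarrow> 'k set set set set" where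
  "matrix_nbhds \<kappa> \<mu> C F = {matrix_nbhd \<kappa> F \<xi> \<alpha> | \<xi> \<alpha>. \<xi> \<in> Field \<mu> \<and> \<alpha> \<in> C}"

definition sym_diff_group :: "'a set \<Rightarrow> 'a set monoid" where
  "sym_diff_group X = \<lparr>carrier = Fpow X, mult = sym_diff, one = {}\<rparr>"

text \<open>No separation axiom is part of the notion of topological group.\<close>

definition topological_group :: "('a, 'b) monoid_scheme \<Rightarrow> 'a topology \<Rightarrow> bool" where
  "topological_group G T \<longleftrightarrow>
     group G \<and> topspace T = carrier G \<and>
     continuous_map (prod_topology T T) T (\<lambda>(x, y). x \<otimes>\<^bsub>G\<^esub> y) \<and>
     continuous_map T T (\<lambda>x. inv\<^bsub>G\<^esub> x)"

text \<open>
  Members of a neighborhood basis are neighborhoods, not necessarily open. The predicate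
  \<^const>\<open>neighbourhood_base_at\<close> alone does not require every member to be a neighborhood.
\<close>

definition neighborhood_basis :: "'a topology \<Rightarrow> 'a \<Rightarrow> 'a set set \<Rightarrow> bool" where
  "neighborhood_basis T x \<B> \<longleftrightarrow>
     x \<in> topspace T \<and>
     (\<forall>V\<in>\<B>. V \<subseteq> topspace T \<and> (\<exists>W. openin T W \<and> x \<in> W \<and> W \<subseteq> V)) \<and>
     neighbourhood_base_at x (\<lambda>V. V \<in> \<B>) T"

end

theory Submission
  imports Defs "HOL-Algebra.Coset"
begin

text \<open>
  Each \<open>U\<^sub>\<xi>(\<alpha>)\<close> is a subgroup, and (G2) and (G3) make these subgroups a filter base. In an abelian
  group any filter base of subgroups is a neighborhood basis of the identity for the group topology
  whose open sets are the unions of cosets of members.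
\<close>

text \<open>\<open>topology\<close> yields the intended open sets only once the predicate is shown
  to satisfy \<open>istopology\<close>; directedness of \<B> supplies this in
  \<open>openin_coset_topology\<close>. Openness is put pointwise, so that closure under unions is
  immediate.\<close>

definition coset_topology :: "('a, 'b) monoid_scheme \<Rightarrow> 'a set set \<Rightarrow> 'a topology" where
  "coset_topology G \<B> =
     topology (\<lambda>W. W \<subseteq> carrier G \<and> (\<forall>x\<in>W. \<exists>H\<in>\<B>. x <#\<^bsub>G\<^esub> H \<subseteq> W))"

lemma l_coset_subset_iff: "x <#\<^bsub>G\<^esub> H \<subseteq> W \<longleftrightarrow> (\<forall>h\<in>H. x \<otimes>\<^bsub>G\<^esub> h \<in> W)"
  by (auto simp: l_coset_def)

text \<open>Commutativity allows a single H to serve for cosets at different points: factors from H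
  can be moved past other elements without replacing H by a conjugate.\<close>

locale subgroup_filter_base = comm_group G for G (structure) +
  fixes \<B> :: "'a set set"
  assumes nonempty: "\<B> \<noteq> {}"
    and subgroups: "H \<in> \<B> \<Longrightarrow> subgroup H G"
    and directed: "H \<in> \<B> \<Longrightarrow> K \<in> \<B> \<Longrightarrow> \<exists>L\<in>\<B>. L \<subseteq> H \<inter> K"
begin

text \<open>At a point of an intersection, \<open>directed\<close> refines the two witnesses H and K
  to some L inside both, and x L lies in x H and in x K. A union inherits the witness of any set
  containing the point.\<close>

lemma openin_coset_topology:
  "openin (coset_topology G \<B>) W \<longleftrightarrow> W \<subseteq> carrier G \<and> (\<forall>x\<in>W. \<exists>H\<in>\<B>. x <# H \<subseteq> W)"
proof -
  have "istopology (\<lambda>W. W \<subseteq> carrier G \<and> (\<forall>x\<in>W. \<exists>H\<in>\<B>. x <# H \<subseteq> W))"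
    unfolding istopology_def
  proof (intro conjI allI impI ballI; (elim conjE)?)
    fix S T x
    assume S: "\<forall>x\<in>S. \<exists>H\<in>\<B>. x <# H \<subseteq> S" and T: "\<forall>x\<in>T. \<exists>H\<in>\<B>. x <# H \<subseteq> T" and x: "x \<in> S \<inter> T"
    obtain H K where H: "H \<in> \<B>" "x <# H \<subseteq> S" and K: "K \<in> \<B>" "x <# K \<subseteq> T"
      using S T x by blast
    obtain L where "L \<in> \<B>" "L \<subseteq> H \<inter> K"
      using directed[OF H(1) K(1)] by blast
    with H K show "\<exists>H\<in>\<B>. x <# H \<subseteq> S \<inter> T"
      by (intro bexI[of _ L]) (auto simp: l_coset_subset_iff)
  next
    fix \<W> x
    assume "\<forall>W\<in>\<W>. W \<subseteq> carrier G \<and> (\<forall>x\<in>W. \<exists>H\<in>\<B>. x <# H \<subseteq> W)" and "x \<in> \<Union>\<W>"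
    then show "\<exists>H\<in>\<B>. x <# H \<subseteq> \<Union>\<W>"
      by (meson Union_iff Union_upper order_trans)
  qed blast+
  then show ?thesis
    by (simp add: coset_topology_def topology_inverse')
qed

text \<open>Every coset of a member stays in the carrier, so any member, provided by
  \<open>nonempty\<close>, witnesses that the carrier is open.\<close>

lemma topspace_coset_topology: "topspace (coset_topology G \<B>) = carrier G"
proof -
  have "openin (coset_topology G \<B>) (carrier G)"
    using nonempty subgroups
    by (fastforce simp: openin_coset_topology l_coset_subset_iff dest: subgroup.mem_carrier)
  then show ?thesis
    by (meson openin_coset_topology openin_subset openin_topspace subset_antisym)
qed

text \<open>Cosets of a subgroup partition the group: z H = x H for each z in x H, so H itself is
  the witness at every point.\<close>

lemma openin_l_coset:
  assumes "H \<in> \<B>" and x: "x \<in> carrier G"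
  shows "openin (coset_topology G \<B>) (x <# H)"
proof -
  interpret H: subgroup H G
    using assms subgroups by blast
  have "z <# H \<subseteq> x <# H" if "z \<in> x <# H" for z
    using l_repr_independence[OF that x] H.subgroup_axioms by simp
  then show ?thesis
    unfolding openin_coset_topology
    using assms H.subset l_coset_subset_G by blast
qed

lemma one_mem: "H \<in> \<B> \<Longrightarrow> \<one> \<in> H"
  using subgroups subgroup.one_closed by metis

lemma mem_l_coset_self: "H \<in> \<B> \<Longrightarrow> x \<in> carrier G \<Longrightarrow> x \<in> x <# H"
  using subgroups by (force simp: l_coset_def dest: subgroup.one_closed)

lemma openin_member: "H \<in> \<B> \<Longrightarrow> openin (coset_topology G \<B>) H"
  using openin_l_coset[of H \<one>] subgroups
  by (simp add: lcos_mult_one subgroup.subset)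

text \<open>If the coset by H of the value of an operation lies in W, then the operation maps the
  cosets by the same H of its arguments into W.\<close>

lemma topological_group_coset_topology: "topological_group G (coset_topology G \<B>)"
  unfolding topological_group_def
proof (intro conjI)
  let ?T = "coset_topology G \<B>"
  show "continuous_map (prod_topology ?T ?T) ?T (\<lambda>(x, y). x \<otimes> y)"
    unfolding continuous_map_def
  proof (intro conjI allI impI)
    fix W assume W: "openin ?T W"
    show "openin (prod_topology ?T ?T)
            {p \<in> topspace (prod_topology ?T ?T). (case p of (x, y) \<Rightarrow> x \<otimes> y) \<in> W}"
      unfolding openin_prod_topology_alt
    proof (intro allI impI)
      fix x y
      assume "(x, y) \<in> {p \<in> topspace (prod_topology ?T ?T). (case p of (x, y) \<Rightarrow> x \<otimes> y) \<in> W}"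
      then have xy: "x \<in> carrier G" "y \<in> carrier G" "x \<otimes> y \<in> W"
        by (auto simp: topspace_coset_topology)
      then obtain H where H: "H \<in> \<B>" "x \<otimes> y <# H \<subseteq> W"
        using W xy unfolding openin_coset_topology by blast
      interpret H: subgroup H G
        using H subgroups by blast
      have "u \<otimes> v \<in> W" if uv: "u \<in> x <# H" "v \<in> y <# H" for u v
      proof -
        obtain h k where hk: "h \<in> H" "k \<in> H" "u = x \<otimes> h" "v = y \<otimes> k"
          using uv by (auto simp: l_coset_def)
        \<comment> \<open>Commutativity moves h past y, and h k remains in H, so the product lies in
          x y H.\<close>
        then have "u \<otimes> v = x \<otimes> y \<otimes> (h \<otimes> k)"
          using xy by (simp add: m_ac)
        with H(2) H.m_closed[OF hk(1,2)] show ?thesis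
          by (simp add: l_coset_subset_iff)
      qed
      moreover have "x <# H \<subseteq> carrier G" "y <# H \<subseteq> carrier G"
        using xy H.subset by (simp_all add: l_coset_subset_G)
      ultimately have "(x <# H) \<times> (y <# H)
          \<subseteq> {p \<in> topspace (prod_topology ?T ?T). (case p of (x, y) \<Rightarrow> x \<otimes> y) \<in> W}"
        by (auto simp: topspace_coset_topology)
      with xy H(1) show "\<exists>U V. openin ?T U \<and> openin ?T V \<and> x \<in> U \<and> y \<in> V \<and>
          U \<times> V \<subseteq> {p \<in> topspace (prod_topology ?T ?T). (case p of (x, y) \<Rightarrow> x \<otimes> y) \<in> W}"
        by (intro exI[of _ "x <# H"] exI[of _ "y <# H"] conjI openin_l_coset mem_l_coset_self)
    qed
  qed (auto simp: topspace_coset_topology)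
  show "continuous_map ?T ?T (\<lambda>x. inv x)"
    unfolding continuous_map_def
  proof (intro conjI allI impI)
    fix W assume W: "openin ?T W"
    have "\<exists>H\<in>\<B>. x <# H \<subseteq> {x \<in> carrier G. inv x \<in> W}"
      if x: "x \<in> carrier G" "inv x \<in> W" for x
    proof -
      obtain H where H: "H \<in> \<B>" "inv x <# H \<subseteq> W"
        using W x unfolding openin_coset_topology by blast
      interpret H: subgroup H G
        using H subgroups by blast
      \<comment> \<open>By commutativity inv (x h) = (inv x) (inv h), which lies in (inv x)
        H.\<close>
      have "inv (x \<otimes> h) \<in> W" if "h \<in> H" for h
        using H(2) that x H.m_inv_closed[OF that] by (simp add: l_coset_subset_iff inv_mult)
      with x H(1) show ?thesis
        by (intro bexI[of _ H]) (auto simp: l_coset_subset_iff)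
    qed
    then show "openin ?T {x \<in> topspace ?T. inv x \<in> W}"
      unfolding openin_coset_topology topspace_coset_topology by blast
  qed (auto simp: topspace_coset_topology)
qed (simp_all add: topspace_coset_topology)

text \<open>Members are open and contain \<one>, so each is a neighborhood of it; conversely, an
  open W containing \<one> contains \<one> H = H for some member H.\<close>

lemma neighborhood_basis_coset_topology: "neighborhood_basis (coset_topology G \<B>) \<one> \<B>"
  unfolding neighborhood_basis_def
proof (intro conjI ballI)
  let ?T = "coset_topology G \<B>"
  show "\<exists>W. openin ?T W \<and> \<one> \<in> W \<and> W \<subseteq> H" if "H \<in> \<B>" for H
    using that openin_member one_mem by blast
  show "neighbourhood_base_at \<one> (\<lambda>V. V \<in> \<B>) ?T"
    unfolding neighbourhood_base_at_def
  proof (intro allI impI, elim conjE)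
    fix W assume "openin ?T W" "\<one> \<in> W"
    then obtain H where H: "H \<in> \<B>" "\<one> <# H \<subseteq> W"
      unfolding openin_coset_topology by blast
    then have "H \<subseteq> W"
      using subgroups by (simp add: lcos_mult_one subgroup.subset)
    \<comment> \<open>Both U and V are taken to be H.\<close>
    with H show "\<exists>U V. openin ?T U \<and> V \<in> \<B> \<and> \<one> \<in> U \<and> U \<subseteq> V \<and> V \<subseteq> W"
      using openin_member[OF H(1)] one_mem[OF H(1)] by blast
  qed
qed (use subgroups subgroup.subset in \<open>auto simp: topspace_coset_topology\<close>)

end

text \<open>The symmetric difference of two finite sets is finite, and every set is its own
  inverse.\<close>

lemma comm_group_sym_diff_group: "comm_group (sym_diff_group X)"
proof (rule comm_groupI)
  fix a assume "a \<in> carrier (sym_diff_group X)"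
  then show "\<exists>b\<in>carrier (sym_diff_group X).
      b \<otimes>\<^bsub>sym_diff_group X\<^esub> a = \<one>\<^bsub>sym_diff_group X\<^esub>"
    by (intro bexI[of _ a]) (auto simp: sym_diff_group_def)
qed (auto simp: sym_diff_group_def Fpow_def)

lemma inv_sym_diff_group:
  assumes "a \<in> Fpow X"
  shows "inv\<^bsub>sym_diff_group X\<^esub> a = a"
proof -
  interpret comm_group "sym_diff_group X"
    by (rule comm_group_sym_diff_group)
  show ?thesis
    by (rule inv_equality) (use assms in \<open>auto simp: sym_diff_group_def\<close>)
qed

text \<open>A symmetric difference is contained in the union, so it avoids
  \<open>F \<xi> \<alpha>\<close> when both sets do; inverses are the elements themselves.\<close>

lemma subgroup_matrix_nbhd:
  "subgroup (matrix_nbhd \<kappa> F \<xi> \<alpha>) (sym_diff_group (Field (cardSuc \<kappa>)))"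
proof
  fix a assume "a \<in> matrix_nbhd \<kappa> F \<xi> \<alpha>"
  then show "inv\<^bsub>sym_diff_group (Field (cardSuc \<kappa>))\<^esub> a \<in> matrix_nbhd \<kappa> F \<xi> \<alpha>"
    by (simp add: matrix_nbhd_def inv_sym_diff_group)
qed (auto simp: matrix_nbhd_def sym_diff_group_def Fpow_def)

text \<open>Infinite cardinals have nonempty fields, and cofinality places an element of C above any
  chosen ordinal.\<close>

lemma matrix_nbhds_nonempty:
  assumes "Cinfinite \<kappa>" "Cinfinite \<mu>" "cofinal C (cardSuc \<kappa>)"
  shows "matrix_nbhds \<kappa> \<mu> C F \<noteq> {}"
proof -
  have "Field \<mu> \<noteq> {}"
    using assms(2) by (metis cinfinite_def finite.emptyI)
  moreover have "Field (cardSuc \<kappa>) \<noteq> {}"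
    using Cinfinite_cardSuc[OF assms(1)] by (metis cinfinite_def finite.emptyI)
  then have "C \<noteq> {}"
    using assms(3) by (auto simp: cofinal_def)
  ultimately show ?thesis
    by (auto simp: matrix_nbhds_def)
qed

text \<open>This becomes directedness of the neighborhoods, since enlarging
  \<open>F \<xi> \<alpha>\<close> shrinks its neighborhood. (G3) moves the set at the smaller of
  \<alpha>, \<beta> into one at the larger, and (G2) merges the two sets there.\<close>

lemma cardinal_matrix_upper_bound:
  assumes "Card_order \<kappa>" "Card_order \<mu>" and M: "cardinal_matrix \<kappa> \<mu> C F"
    and "\<xi> \<in> Field \<mu>" "\<eta> \<in> Field \<mu>" "\<alpha> \<in> C" "\<beta> \<in> C"
  shows "\<exists>\<zeta>\<in>Field \<mu>. \<exists>\<gamma>\<in>C. F \<xi> \<alpha> \<union> F \<eta> \<beta> \<subseteq> F \<zeta> \<gamma>"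
proof -
  \<comment> \<open>Stated for a general r because it is applied both to \<mu> and to
    \<open>cardSuc \<kappa>\<close>.\<close>
  have total: "(i, j) \<in> r \<or> (j, i) \<in> r" if "Card_order r" "i \<in> Field r" "j \<in> Field r"
    for r :: "'x rel" and i j
    using that wo_rel.TOTALS[of r] by (auto simp: wo_rel_def card_order_on_well_order_on)
  \<comment> \<open>The case \<alpha> \<le> \<beta>, with all indices generalized so that it can be
    reused with the two pairs exchanged.\<close>
  have *: "\<exists>\<zeta>\<in>Field \<mu>. F \<xi> \<alpha> \<union> F \<eta> \<beta> \<subseteq> F \<zeta> \<beta>"
    if le: "(\<alpha>, \<beta>) \<in> cardSuc \<kappa>" and mem: "\<xi> \<in> Field \<mu>" "\<eta> \<in> Field \<mu>" "\<alpha> \<in> C" "\<beta> \<in> C"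
    for \<xi> \<eta> \<alpha> \<beta>
  proof -
    have mono: "F i \<beta> \<subseteq> F j \<beta>" if "(i, j) \<in> \<mu>" for i j
      using M that \<open>\<beta> \<in> C\<close> by (auto simp: cardinal_matrix_def)
    obtain \<eta>' where "\<eta>' \<in> Field \<mu>" "F \<xi> \<alpha> \<subseteq> F \<eta>' \<beta>"
      using M le mem unfolding cardinal_matrix_def by meson
    then show ?thesis
      \<comment> \<open>The witness \<zeta> is the larger of \<eta> and \<eta>'.\<close>
      using total[OF assms(2), of \<eta> \<eta>'] mono[of \<eta> \<eta>'] mono[of \<eta>' \<eta>] \<open>\<eta> \<in> Field \<mu>\<close> by blast
  qed
  have "(\<alpha>, \<beta>) \<in> cardSuc \<kappa> \<or> (\<beta>, \<alpha>) \<in> cardSuc \<kappa>"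
    using assms by (intro total cardSuc_Card_order) (auto simp: cardinal_matrix_def)
  then show ?thesis
    using *[of \<alpha> \<beta> \<xi> \<eta>] *[of \<beta> \<alpha> \<eta> \<xi>] assms by (metis Un_commute)
qed

theorem theorem3p1:
  fixes \<kappa> :: "'k rel" and \<mu> :: "'l rel"
    and C :: "'k set set" and F :: "'l \<Rightarrow> 'k set \<Rightarrow> 'k set set"
  assumes "Cinfinite \<kappa>" and "regularCard \<kappa>"
    and "Cinfinite \<mu>" and "regularCard \<mu>"
    and "\<mu> \<le>o \<kappa>"
    and "cardinal_matrix \<kappa> \<mu> C F"
  shows "\<exists>T. neighborhood_basis T {} (matrix_nbhds \<kappa> \<mu> C F) \<and>
             topological_group (sym_diff_group (Field (cardSuc \<kappa>))) T"
proof -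
  let ?G = "sym_diff_group (Field (cardSuc \<kappa>))" and ?B = "matrix_nbhds \<kappa> \<mu> C F"
  interpret subgroup_filter_base ?G ?B
  proof (intro subgroup_filter_base.intro subgroup_filter_base_axioms.intro
      comm_group_sym_diff_group)
    show "?B \<noteq> {}"
      using assms by (intro matrix_nbhds_nonempty) (auto simp: cardinal_matrix_def)
    show "subgroup H ?G" if "H \<in> ?B" for H
      using that subgroup_matrix_nbhd by (auto simp: matrix_nbhds_def)
    fix H K assume "H \<in> ?B" "K \<in> ?B"
    then obtain \<xi> \<alpha> \<eta> \<beta> where HK: "\<xi> \<in> Field \<mu>" "\<eta> \<in> Field \<mu>" "\<alpha> \<in> C" "\<beta> \<in> C"
        "H = matrix_nbhd \<kappa> F \<xi> \<alpha>" "K = matrix_nbhd \<kappa> F \<eta> \<beta>"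
      by (auto simp: matrix_nbhds_def)
    then obtain \<zeta> \<gamma> where "\<zeta> \<in> Field \<mu>" "\<gamma> \<in> C" "F \<xi> \<alpha> \<union> F \<eta> \<beta> \<subseteq> F \<zeta> \<gamma>"
      using cardinal_matrix_upper_bound[of \<kappa> \<mu> C F \<xi> \<eta> \<alpha> \<beta>] assms by blast
    \<comment> \<open>A finite set disjoint from \<open>F \<zeta> \<gamma>\<close> is disjoint from
      both sets below it.\<close>
    with HK show "\<exists>L\<in>?B. L \<subseteq> H \<inter> K"
      by (intro bexI[of _ "matrix_nbhd \<kappa> F \<zeta> \<gamma>"]) (auto simp: matrix_nbhd_def matrix_nbhds_def)
  qed
  show ?thesis
    \<comment> \<open>The topology is \<open>coset_topology ?G ?B\<close>; unfolding the group turns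
      its identity into the empty set.\<close>
    using neighborhood_basis_coset_topology topological_group_coset_topology
    by (auto simp: sym_diff_group_def)
qed

end
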